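(* Let $k$ be a non-negative integer and let $M$ be a simple binary $k$-paving matroid of rank $r$, where $M$ is not a circuit (i.e., $E(M)$ is not itself a circuit of $M$) and $r \geq k+4$. Let $t = \lfloor \frac{3k+1-r}{2} \rfloor$. Then $r(M) \leq 3k+1$, and $$|E(M)| \leq (r+1) + \sum_{i=0}^{t} \binom{k}{i}.$$
   Context: For a matroid $M$ of rank $r$ and a non-negative integer $k$, an element of $M$ is called $k$-loose if every circuit of $M$ that contains it has size greater than $r-k$; $M$ is $k$-paving if every element of $M$ is $k$-loose. A binary matroid is one representable over $GF(2)$; a matroid is simple if it has no loops and no parallel pairs. An empty sum is zero.
   Formalization: The bound r(M) ≤ 3k+1 is stated only when M has two distinct circuits, since it fails otherwise (e.g. U_{4,4} with k=0, or a circuit with a coloop added); the bound on |E(M)| is under the original hypotheses. *)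

theory Defs
  imports Complex_Main "HOL-Library.Z2"
begin

locale matroid =
  fixes E :: "'a set" and indep :: "'a set \<Rightarrow> bool"
  assumes finite_ground: "finite E"
    and indep_subset_ground: "indep X \<Longrightarrow> X \<subseteq> E"
    and indep_empty: "indep {}"
    and indep_subset: "indep X \<Longrightarrow> Y \<subseteq> X \<Longrightarrow> indep Y"
    and indep_augment:
      "indep X \<Longrightarrow> indep Y \<Longrightarrow> card X < card Y \<Longrightarrow> \<exists>y\<in>Y - X. indep (insert y X)"

definition circuit :: "'a set \<Rightarrow> ('a set \<Rightarrow> bool) \<Rightarrow> 'a set \<Rightarrow> bool" where
  "circuit E indep C \<longleftrightarrow> C \<subseteq> E \<and> \<not> indep C \<and> (\<forall>D. D \<subset> C \<longrightarrow> indep D)"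

definition matroid_rank :: "'a set \<Rightarrow> ('a set \<Rightarrow> bool) \<Rightarrow> nat" where
  "matroid_rank E indep = Max (card ` {X. X \<subseteq> E \<and> indep X})"

definition loop :: "'a set \<Rightarrow> ('a set \<Rightarrow> bool) \<Rightarrow> 'a \<Rightarrow> bool" where
  "loop E indep e \<longleftrightarrow> circuit E indep {e}"

definition parallel_pair :: "'a set \<Rightarrow> ('a set \<Rightarrow> bool) \<Rightarrow> 'a \<Rightarrow> 'a \<Rightarrow> bool" where
  "parallel_pair E indep e f \<longleftrightarrow> e \<noteq> f \<and> circuit E indep {e, f}"

definition simple_matroid :: "'a set \<Rightarrow> ('a set \<Rightarrow> bool) \<Rightarrow> bool" where
  "simple_matroid E indep \<longleftrightarrow>
     (\<forall>e\<in>E. \<not> loop E indep e) \<and> (\<forall>e\<in>E. \<forall>f\<in>E. \<not> parallel_pair E indep e f)"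

text \<open>A matrix with \<open>m\<close> rows and columns labelled by \<open>'a\<close> has entry \<open>A i x\<close> in row \<open>i < m\<close> and
  column \<open>x\<close>. The columns labelled by a finite set \<open>X\<close> are treated as a family, so two equal
  columns with distinct labels are dependent.\<close>

definition columns_independent :: "nat \<Rightarrow> (nat \<Rightarrow> 'a \<Rightarrow> 'f::field) \<Rightarrow> 'a set \<Rightarrow> bool" where
  "columns_independent m A X \<longleftrightarrow>
     (\<forall>c. (\<forall>i<m. (\<Sum>x\<in>X. c x * A i x) = 0) \<longrightarrow> (\<forall>x\<in>X. c x = 0))"

definition representable_over :: "'f::field itself \<Rightarrow> 'a set \<Rightarrow> ('a set \<Rightarrow> bool) \<Rightarrow> bool" where
  "representable_over F E indep \<longleftrightarrow>
     (\<exists>m (A :: nat \<Rightarrow> 'a \<Rightarrow> 'f). \<forall>X\<subseteq>E. indep X \<longleftrightarrow> columns_independent m A X)"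

text \<open>The type \<^typ>\<open>bit\<close> is the two-element field.\<close>

definition binary_matroid :: "'a set \<Rightarrow> ('a set \<Rightarrow> bool) \<Rightarrow> bool" where
  "binary_matroid E indep \<longleftrightarrow> representable_over TYPE(bit) E indep"

text \<open>The difference of rank and \<open>k\<close> is taken in the integers, as it may be negative. An element
  in no circuit (a coloop) is \<open>k\<close>-loose for every \<open>k\<close>. Hence free matroids are \<open>k\<close>-paving for every
  \<open>k\<close>, and so are circuits with at most \<open>k\<close> coloops adjoined; the ranks of both are unbounded.
  These are exactly the \<open>k\<close>-paving matroids with at most one circuit.\<close>

definition k_loose :: "nat \<Rightarrow> 'a set \<Rightarrow> ('a set \<Rightarrow> bool) \<Rightarrow> 'a \<Rightarrow> bool" where
  "k_loose k E indep e \<longleftrightarrow>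
     (\<forall>C. circuit E indep C \<and> e \<in> C \<longrightarrow> int (card C) > int (matroid_rank E indep) - int k)"

definition k_paving :: "nat \<Rightarrow> 'a set \<Rightarrow> ('a set \<Rightarrow> bool) \<Rightarrow> bool" where
  "k_paving k E indep \<longleftrightarrow> (\<forall>e\<in>E. k_loose k E indep e)"

end

theory Submission
  imports Defs
begin

text \<open>The cycles (the kernel of the representing matrix) form a binary code whose minimum
  distance \<open>d\<close> exceeds \<open>r - k\<close>. Take a minimum circuit \<open>C\<close>, an element \<open>f\<close> of it and a basis
  \<open>B\<close> containing \<open>C - {f}\<close>. For \<open>e\<close> outside \<open>B\<close>, let \<open>D e\<close> be the part of \<open>B\<close> missed by the
  fundamental circuit of \<open>e\<close>. Sums of one, two and three fundamental circuits have size at least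
  \<open>d\<close>, which bounds the size of \<open>D e\<close> from above, the size of the sum of \<open>D e\<close> and \<open>D g\<close> from
  below, and the size of the sum of \<open>D e\<close>, \<open>D g\<close>, \<open>D f\<close> from above. The first two bounds
  give the rank bound and show that \<open>D e\<close> and \<open>D f\<close> share at most \<open>t\<close> elements. Since \<open>D f\<close> has
  the largest possible size, the last two make \<open>e \<mapsto> D e \<inter> D f\<close> injective on the elements
  outside \<open>B\<close> other than \<open>f\<close>, so their number is at most that of the subsets of \<open>D f\<close> with at
  most \<open>t\<close> elements.\<close>

section \<open>Symmetric differences and binomial sums\<close>

lemma card_sym_diff:
  assumes "finite X" "finite Y"
  shows "card (sym_diff X Y) + 2 * card (X \<inter> Y) = card X + card Y"
proof -
  have "card (sym_diff X Y) = card (X - Y) + card (Y - X)"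
    using assms by (intro card_Un_disjoint) auto
  moreover have "card X = card (X - Y) + card (X \<inter> Y)"
    using assms by (metis card_Int_Diff add.commute)
  moreover have "card Y = card (Y - X) + card (X \<inter> Y)"
    using assms by (metis card_Int_Diff add.commute Int_commute)
  ultimately show ?thesis by simp
qed

text \<open>The common part is counted twice on the right and cancels in characteristic 2.\<close>

lemma sum_sym_diff_bit:
  fixes h :: "'a \<Rightarrow> bit"
  assumes "finite X" "finite Y"
  shows "sum h (sym_diff X Y) = sum h X + sum h Y"
proof -
  have "sum h (sym_diff X Y) = sum h (X - Y) + sum h (Y - X)"
    using assms by (intro sum.union_disjoint) auto
  moreover have "sum h X = sum h (X \<inter> Y) + sum h (X - Y)"
    using assms by (metis sum.Int_Diff)
  moreover have "sum h Y = sum h (X \<inter> Y) + sum h (Y - X)"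
    using assms by (metis sum.Int_Diff Int_commute)
  moreover have "a + b + (a + c) = b + c" for a b c :: bit
    by (cases a; cases b; cases c) simp_all
  ultimately show ?thesis by simp
qed

lemma card_subsets_card_le:
  assumes "finite A"
  shows "card {X. X \<subseteq> A \<and> card X \<le> m} = (\<Sum>i\<le>m. card A choose i)"
proof -
  have "{X. X \<subseteq> A \<and> card X \<le> m} = (\<Union>i\<in>{..m}. {X. X \<subseteq> A \<and> card X = i})"
    by auto
  also have "card \<dots> = (\<Sum>i\<le>m. card {X. X \<subseteq> A \<and> card X = i})"
    by (intro card_UN_disjoint) (auto simp: assms)
  also have "\<dots> = (\<Sum>i\<le>m. card A choose i)"
    using n_subsets[OF assms] by simp
  finally show ?thesis .
qed

lemma binomial_mono_upper: "m \<le> n \<Longrightarrow> m choose i \<le> n choose i"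
proof (induction n rule: dec_induct)
  case (step n)
  then show ?case by (cases i) auto
qed simp

section \<open>Extension to bases\<close>

context matroid
begin

lemma finite_indep: "indep X \<Longrightarrow> finite X"
  using finite_subset[OF indep_subset_ground finite_ground] .

lemma finite_indep_cards: "finite (card ` {X. X \<subseteq> E \<and> indep X})"
  using finite_ground by simp

lemma card_indep_le_rank: "indep X \<Longrightarrow> card X \<le> matroid_rank E indep"
  unfolding matroid_rank_def
  by (rule Max_ge[OF finite_indep_cards]) (use indep_subset_ground in auto)

text \<open>If a largest independent superset of \<open>I\<close> were smaller than a maximum
  independent set, augmentation would enlarge it.\<close>

lemma extend_to_basis:
  assumes "indep I"
  obtains B where "I \<subseteq> B" "indep B" "card B = matroid_rank E indep"
proof -
  have "matroid_rank E indep \<in> card ` {X. X \<subseteq> E \<and> indep X}"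
    unfolding matroid_rank_def using indep_empty
    by (intro Max_in[OF finite_indep_cards]) auto
  then obtain X where X: "indep X" "card X = matroid_rank E indep" by auto
  have "\<exists>B. (I \<subseteq> B \<and> indep B) \<and> (\<forall>Y. I \<subseteq> Y \<and> indep Y \<longrightarrow> card Y \<le> card B)"
    by (rule ex_has_greatest_nat[where b = "Suc (matroid_rank E indep)"])
      (use assms card_indep_le_rank in \<open>auto simp: less_Suc_eq_le\<close>)
  then obtain B where B: "I \<subseteq> B" "indep B" "\<And>Y. I \<subseteq> Y \<Longrightarrow> indep Y \<Longrightarrow> card Y \<le> card B"
    by blast
  have "\<not> card B < card X"
  proof
    assume "card B < card X"
    then obtain y where "y \<in> X - B" "indep (insert y B)"
      using indep_augment B X by blast
    then show False
      using B(1) B(3)[of "insert y B"] finite_indep[OF B(2)] by auto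
  qed
  then have "card B = matroid_rank E indep"
    using X card_indep_le_rank[OF B(2)] by simp
  then show ?thesis using that B by blast
qed

end

section \<open>Cycle spaces\<close>

text \<open>Over GF(2) a kernel vector is determined by its support and addition is symmetric
  difference, so \<open>\<C>\<close> plays the kernel of the representing matrix.\<close>

locale binary_cycles = matroid +
  fixes \<C> :: "'a set set"
  assumes cycle_ground: "Z \<in> \<C> \<Longrightarrow> Z \<subseteq> E"
    and cycle_sym_diff: "Y \<in> \<C> \<Longrightarrow> Z \<in> \<C> \<Longrightarrow> sym_diff Y Z \<in> \<C>"
    and indep_iff: "X \<subseteq> E \<Longrightarrow> indep X \<longleftrightarrow> (\<forall>Z\<in>\<C>. Z \<subseteq> X \<longrightarrow> Z = {})"
begin

lemma dependent_contains_cycle: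
  assumes "X \<subseteq> E" "\<not> indep X"
  obtains Z where "Z \<in> \<C>" "Z \<subseteq> X" "Z \<noteq> {}"
  using assms indep_iff by blast

lemma cycle_dependent: "Z \<in> \<C> \<Longrightarrow> Z \<subseteq> X \<Longrightarrow> Z \<noteq> {} \<Longrightarrow> \<not> indep X"
  using indep_iff indep_subset_ground by blast

lemma circuit_is_cycle:
  assumes "circuit E indep C"
  shows "C \<in> \<C>" "C \<noteq> {}"
proof -
  have C: "C \<subseteq> E" "\<not> indep C" "\<And>D. D \<subset> C \<Longrightarrow> indep D"
    using assms by (auto simp: circuit_def)
  then obtain Z where "Z \<in> \<C>" "Z \<subseteq> C" "Z \<noteq> {}"
    using dependent_contains_cycle by blast
  then show "C \<in> \<C>" using C(3) cycle_dependent by (metis psubsetI order_refl)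
  show "C \<noteq> {}" using C(2) indep_empty by blast
qed

text \<open>A dependent proper subset of a smallest nonempty cycle would contain a smaller one. Thus
  a lower bound on circuit sizes is inherited by all nonempty cycles.\<close>

lemma minimum_circuit:
  assumes "\<not> indep E"
  obtains C where "circuit E indep C" "\<And>Z. Z \<in> \<C> \<Longrightarrow> Z \<noteq> {} \<Longrightarrow> card C \<le> card Z"
proof -
  obtain Z where "Z \<in> \<C>" "Z \<noteq> {}" using dependent_contains_cycle assms by blast
  then obtain C where C: "C \<in> \<C>" "C \<noteq> {}" "\<And>Z. Z \<in> \<C> \<Longrightarrow> Z \<noteq> {} \<Longrightarrow> card C \<le> card Z"
    using ex_has_least_nat[of "\<lambda>Z. Z \<in> \<C> \<and> Z \<noteq> {}" Z card] by blast
  have "C \<subseteq> E" using C(1) cycle_ground by blast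
  then have "finite C" using finite_ground finite_subset by blast
  have "indep D" if D: "D \<subset> C" for D
  proof (rule ccontr)
    assume "\<not> indep D"
    then obtain Z where Z: "Z \<in> \<C>" "Z \<subseteq> D" "Z \<noteq> {}"
      using dependent_contains_cycle D \<open>C \<subseteq> E\<close> by blast
    then have "card Z < card C" using D \<open>finite C\<close> by (intro psubset_card_mono) auto
    then show False using C(3)[OF Z(1,3)] by simp
  qed
  then have "circuit E indep C"
    using \<open>C \<subseteq> E\<close> cycle_dependent[OF C(1) order_refl C(2)] by (simp add: circuit_def)
  then show ?thesis using that C(3) by blast
qed

lemma fundamental_cycle:
  assumes "indep B" "card B = matroid_rank E indep" "e \<in> E - B"
  obtains Z where "Z \<in> \<C>" "e \<in> Z" "Z \<subseteq> insert e B"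
proof -
  have "\<not> indep (insert e B)"
    using card_indep_le_rank[of "insert e B"] assms finite_indep by auto
  then obtain Z where "Z \<in> \<C>" "Z \<subseteq> insert e B" "Z \<noteq> {}"
    using dependent_contains_cycle[of "insert e B"] assms indep_subset_ground by blast
  moreover from this have "e \<in> Z" using cycle_dependent[of Z B] assms(1) by blast
  ultimately show ?thesis using that by blast
qed

text \<open>Neither circuit lies in \<open>B\<close>. If both met the complement of \<open>B\<close>
  in the same single element, their symmetric difference would be a nonempty cycle inside
  \<open>B\<close>.\<close>

lemma two_circuits_cobasis:
  assumes B: "indep B" and C: "circuit E indep C" "circuit E indep D" "C \<noteq> D"
  obtains e g where "e \<in> E - B" "g \<in> E - B" "e \<noteq> g"
proof -
  have cyc: "C \<in> \<C>" "D \<in> \<C>" "C \<noteq> {}" "D \<noteq> {}" using C circuit_is_cycle by auto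
  then have "\<not> sym_diff C D \<subseteq> B"
    using cycle_dependent[OF cycle_sym_diff] B C(3) by blast
  moreover have "\<not> C \<subseteq> B" "\<not> D \<subseteq> B" using cyc cycle_dependent B by blast+
  ultimately show ?thesis using that cycle_ground cyc(1,2) by blast
qed

section \<open>Counting the elements outside a basis\<close>

text \<open>The bounds use \<open>k' = r + 1 - d\<close>, with \<open>d\<close> the least circuit
  size, because the argument needs a set \<open>D f\<close> of extremal size; \<open>k'\<close> may
  be smaller than \<open>k\<close>.\<close>

lemma paving_bounds:
  assumes paving: "k_paving k E indep" and r: "matroid_rank E indep = r" and "r \<ge> k + 4"
    and dep: "\<not> indep E"
  obtains B k' where "indep B" "card B = r" "k' \<le> k"
    "\<And>e g. e \<in> E - B \<Longrightarrow> g \<in> E - B \<Longrightarrow> e \<noteq> g \<Longrightarrow> r \<le> 3 * k' + 1"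
    "card (E - B) \<le> 1 + (\<Sum>i\<le>(3 * k' + 1 - r) div 2. k' choose i)"
proof -
  obtain C where circ: "circuit E indep C"
    and min: "\<And>Z. Z \<in> \<C> \<Longrightarrow> Z \<noteq> {} \<Longrightarrow> card C \<le> card Z"
    using minimum_circuit[OF dep] by blast
  note C = circuit_is_cycle[OF circ] min
  have "finite C" using cycle_ground[OF C(1)] finite_ground finite_subset by blast
  obtain f where f: "f \<in> C" using C(2) by blast
  have "f \<in> E" using f cycle_ground[OF C(1)] by blast
  define d where "d = card C"
  have d: "d > 0" "d > r - k"
    using paving circ f \<open>f \<in> E\<close> r \<open>finite C\<close> C(2) \<open>r \<ge> k + 4\<close>
    by (fastforce simp: d_def k_paving_def k_loose_def card_gt_0_iff)+
  have "indep (C - {f})" using circ f by (auto simp: circuit_def)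
  then obtain B where B: "C - {f} \<subseteq> B" "indep B" "card B = r"
    using extend_to_basis r by metis
  have "finite B" using finite_indep B by blast
  have "f \<notin> B" using B C(1,2) cycle_dependent[of C B] by blast
  define F where "F = E - B"
  have "f \<in> F" using \<open>f \<notin> B\<close> \<open>f \<in> E\<close> by (simp add: F_def)
  have "finite F" using finite_ground by (simp add: F_def)
  \<comment> \<open>Fixing \<open>Z f = C\<close> gives \<open>D f\<close> the largest size among
    the sets \<open>D e\<close>.\<close>
  have "\<exists>Z. Z \<in> \<C> \<and> e \<in> Z \<and> Z \<subseteq> insert e B \<and> (e = f \<longrightarrow> Z = C)" if "e \<in> F" for e
  proof (cases "e = f")
    case True
    then show ?thesis using C(1) f B(1) by blast
  next
    case False
    have "e \<in> E - B" "card B = matroid_rank E indep" using that B(3) r by (auto simp: F_def)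
    then show ?thesis using fundamental_cycle[OF B(2)] False by metis
  qed
  then obtain Z where Z: "\<And>e. e \<in> F \<Longrightarrow> Z e \<in> \<C>" "\<And>e. e \<in> F \<Longrightarrow> e \<in> Z e"
      "\<And>e. e \<in> F \<Longrightarrow> Z e \<subseteq> insert e B" "Z f = C"
    using \<open>f \<in> F\<close> by metis
  define D where "D e = B - Z e" for e
  have D_sub: "D e \<subseteq> B" for e by (auto simp: D_def)
  have finD: "finite (D e)" for e using D_sub \<open>finite B\<close> finite_subset by blast
  have F_notin: "e \<notin> B" if "e \<in> F" for e using that by (simp add: F_def)
  have card_co: "card (B - X) + card X = r" if "X \<subseteq> B" for X
    using that B(3) \<open>finite B\<close> card_Diff_subset[of X B] card_mono[of B X] finite_subset[of X B]
    by simp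
  have card_Z: "card (Z e) + card (D e) = r + 1" if "e \<in> F" for e
  proof -
    have "Z e = insert e (B - D e)" using Z(2,3)[OF that] F_notin[OF that] by (auto simp: D_def)
    then have "card (Z e) = Suc (card (B - D e))"
      using F_notin[OF that] \<open>finite B\<close> by simp
    then show ?thesis using card_co[OF D_sub] by simp
  qed
  define k' where "k' = card (D f)"
  have k': "d + k' = r + 1" using card_Z[OF \<open>f \<in> F\<close>] Z(4) by (simp add: d_def k'_def)
  have "k' \<le> k" using k' d \<open>r \<ge> k + 4\<close> by linarith
  have D_le: "card (D e) \<le> k'" if "e \<in> F" for e
    using C(3)[OF Z(1)[OF that]] Z(2)[OF that] card_Z[OF that] k' by (force simp: d_def)
  have two: "card (sym_diff (D e) (D g)) + 2 \<ge> d" if "e \<in> F" "g \<in> F" "e \<noteq> g" for e g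
  proof -
    \<comment> \<open>Complementing both sets within \<open>B\<close> does not change their
      symmetric difference; outside \<open>B\<close> exactly \<open>e\<close> and \<open>g\<close>
      survive.\<close>
    have eq: "sym_diff (Z e) (Z g) = insert e (insert g (sym_diff (D e) (D g)))"
      using Z(2,3)[OF that(1)] Z(2,3)[OF that(2)] F_notin[OF that(1)] F_notin[OF that(2)] that(3)
      by (auto simp: D_def)
    have "card (sym_diff (Z e) (Z g)) = card (sym_diff (D e) (D g)) + 2"
      unfolding eq using that(3) F_notin[OF that(1)] F_notin[OF that(2)] D_sub finD
      by (subst card_insert_disjoint) (auto simp: D_def)
    moreover have "d \<le> card (sym_diff (Z e) (Z g))"
      unfolding d_def using C(3)[OF cycle_sym_diff[OF Z(1)[OF that(1)] Z(1)[OF that(2)]]] eq by blast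
    ultimately show ?thesis by simp
  qed
  have three: "card (sym_diff (sym_diff (D e) (D g)) (D f)) + d \<le> r + 3"
    if "e \<in> F" "g \<in> F" "e \<noteq> g" "e \<noteq> f" "g \<noteq> f" for e g
  proof -
    let ?S = "sym_diff (sym_diff (D e) (D g)) (D f)"
    let ?T = "sym_diff (sym_diff (Z e) (Z g)) (Z f)"
    note ins = F_notin[OF that(1)] F_notin[OF that(2)] \<open>f \<notin> B\<close>
    \<comment> \<open>The sum of three complements within \<open>B\<close> is the complement of the
      sum, the number of terms being odd.\<close>
    have eq: "?T = {e, g, f} \<union> (B - ?S)"
      using Z(2,3)[OF that(1)] Z(2,3)[OF that(2)] Z(2,3)[OF \<open>f \<in> F\<close>] ins that(3-5)
      unfolding D_def by blast
    have "card ?T = card {e, g, f} + card (B - ?S)"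
      unfolding eq using ins \<open>finite B\<close> by (intro card_Un_disjoint) auto
    also have "\<dots> = 3 + card (B - ?S)" using that(3-5) by simp
    finally have "card ?T = 3 + card (B - ?S)" .
    moreover have "card (B - ?S) + card ?S = r" by (rule card_co) (auto simp: D_def)
    moreover have "d \<le> card ?T"
      unfolding d_def
      using C(3)[OF cycle_sym_diff[OF cycle_sym_diff[OF Z(1)[OF that(1)] Z(1)[OF that(2)]]
            Z(1)[OF \<open>f \<in> F\<close>]]] eq by blast
    ultimately show ?thesis by linarith
  qed
  \<comment> \<open>Twice the intersection is at most \<open>2 * k' - (d - 2)\<close>, where
    \<open>d = r + 1 - k'\<close>.\<close>
  have meet: "2 * card (D e \<inter> D g) + r \<le> 3 * k' + 1" if "e \<in> F" "g \<in> F" "e \<noteq> g" for e g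
    using card_sym_diff[OF finD finD, of e g] two[OF that] D_le[OF that(1)] D_le[OF that(2)] k'
    by linarith
  have inj: "inj_on (\<lambda>e. D e \<inter> D f) (F - {f})"
  proof (rule inj_onI, rule ccontr)
    fix e g
    assume e: "e \<in> F - {f}" and g: "g \<in> F - {f}" and eq: "D e \<inter> D f = D g \<inter> D f" and "e \<noteq> g"
    \<comment> \<open>By disjointness, \<open>three\<close> leaves at most 2 elements for the sum of
      \<open>D e\<close> and \<open>D g\<close>, while \<open>two\<close> demands
      \<open>d - 2 = r - 1 - k'\<close>, which is at least 3 by
      \<open>r \<ge> k + 4\<close>.\<close>
    have "sym_diff (D e) (D g) \<inter> D f = {}" using eq by blast
    then have "card (sym_diff (sym_diff (D e) (D g)) (D f)) = card (sym_diff (D e) (D g)) + k'"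
      using card_sym_diff[of "sym_diff (D e) (D g)" "D f"] finD by (simp add: k'_def)
    then show False
      using two[of e g] three[of e g] e g \<open>e \<noteq> g\<close> k' \<open>k' \<le> k\<close> \<open>r \<ge> k + 4\<close> by simp
  qed
  show ?thesis
  proof (rule that[OF B(2,3) \<open>k' \<le> k\<close>])
    show "r \<le> 3 * k' + 1" if "e \<in> E - B" "g \<in> E - B" "e \<noteq> g" for e g
      using meet[of e g] that by (simp add: F_def)
    have "(\<lambda>e. D e \<inter> D f) ` (F - {f}) \<subseteq> {X. X \<subseteq> D f \<and> card X \<le> (3 * k' + 1 - r) div 2}"
    proof clarsimp
      fix e assume "e \<in> F" "e \<noteq> f"
      then show "card (D e \<inter> D f) \<le> (Suc (3 * k') - r) div 2"
        using meet[of e f] \<open>f \<in> F\<close> by linarith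
    qed
    then have "card (F - {f}) \<le> card {X. X \<subseteq> D f \<and> card X \<le> (3 * k' + 1 - r) div 2}"
      using card_inj_on_le[OF inj] finD by simp
    then show "card (E - B) \<le> 1 + (\<Sum>i\<le>(3 * k' + 1 - r) div 2. k' choose i)"
      using \<open>f \<in> F\<close> \<open>finite F\<close>
      by (simp add: card_subsets_card_le[OF finD] k'_def[symmetric] F_def)
  qed
qed

end

section \<open>From matrices to cycle spaces\<close>

lemma binary_matroid_cycles:
  assumes "matroid E indep" "binary_matroid E indep"
  obtains \<C> where "binary_cycles E indep \<C>"
proof -
  interpret matroid E indep by fact
  obtain m and A :: "nat \<Rightarrow> 'a \<Rightarrow> bit"
    where A: "\<And>X. X \<subseteq> E \<Longrightarrow> indep X \<longleftrightarrow> columns_independent m A X"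
    using assms(2) by (auto simp: binary_matroid_def representable_over_def)
  define \<C> where "\<C> = {Z. Z \<subseteq> E \<and> (\<forall>i<m. (\<Sum>x\<in>Z. A i x) = 0)}"
  have fin: "finite X" if "X \<subseteq> E" for X using that finite_ground finite_subset by blast
  have "binary_cycles E indep \<C>"
  proof unfold_locales
    show "Z \<in> \<C> \<Longrightarrow> Z \<subseteq> E" for Z by (simp add: \<C>_def)
    show "Y \<in> \<C> \<Longrightarrow> Z \<in> \<C> \<Longrightarrow> sym_diff Y Z \<in> \<C>" for Y Z
      using sum_sym_diff_bit[OF fin fin] by (auto simp: \<C>_def)
    fix X assume X: "X \<subseteq> E"
    \<comment> \<open>A nonzero coefficient in \<open>bit\<close> is 1, so linear combinations
      become sums over supports.\<close>
    have supp: "(\<Sum>x\<in>X. c x * h x) = (\<Sum>x\<in>{x \<in> X. c x \<noteq> 0}. h x)" for c h :: "'a \<Rightarrow> bit"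
      unfolding sum.inter_filter[OF fin[OF X]] by (rule sum.cong[OF refl]) simp
    show "indep X \<longleftrightarrow> (\<forall>Z\<in>\<C>. Z \<subseteq> X \<longrightarrow> Z = {})"
      unfolding A[OF X] columns_independent_def supp
    proof safe
      fix Z x
      assume *: "\<forall>c. (\<forall>i<m. sum (A i) {x \<in> X. c x \<noteq> (0::bit)} = 0) \<longrightarrow> (\<forall>x\<in>X. c x = 0)"
        and Z: "Z \<in> \<C>" "Z \<subseteq> X" "x \<in> Z"
      have "{x \<in> X. (if x \<in> Z then 1 else 0) \<noteq> (0::bit)} = Z" using Z(2) by auto
      then show "x \<in> {}"
        using *[rule_format, of "\<lambda>x. if x \<in> Z then 1 else 0" x] Z by (auto simp: \<C>_def)
    next
      fix c :: "'a \<Rightarrow> bit" and x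
      assume *: "\<forall>Z\<in>\<C>. Z \<subseteq> X \<longrightarrow> Z = {}" and "\<forall>i<m. sum (A i) {x \<in> X. c x \<noteq> 0} = 0" "x \<in> X"
      then have "{x \<in> X. c x \<noteq> 0} \<in> \<C>" using X by (auto simp: \<C>_def)
      then have "{x \<in> X. c x \<noteq> 0} = {}" using *[rule_format, of "{x \<in> X. c x \<noteq> 0}"] by simp
      then show "c x = 0" using \<open>x \<in> X\<close> by simp
    qed
  qed
  then show ?thesis using that by blast
qed

text \<open>Free matroids, and single circuits with coloops, can have arbitrarily large rank, so the
  rank bound is stated given two distinct circuits. In the exceptional cases \<open>t\<close> may be
  negative, making the sum empty.\<close>

theorem theorem1p5:
  fixes E :: "'a set" and indep :: "'a set \<Rightarrow> bool" and k r :: nat and t :: int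
  assumes "matroid E indep"
    and "simple_matroid E indep"
    and "binary_matroid E indep"
    and "k_paving k E indep"
    and "matroid_rank E indep = r"
    and "\<not> circuit E indep E"
    and "r \<ge> k + 4"
    and "t = \<lfloor>(3 * real k + 1 - real r) / 2\<rfloor>"
  shows "((\<exists>C D. circuit E indep C \<and> circuit E indep D \<and> C \<noteq> D) \<longrightarrow> r \<le> 3 * k + 1) \<and>
         card E \<le> (r + 1) + (\<Sum>i\<in>{0..t}. k choose nat i)"
proof -
  obtain \<C> where "binary_cycles E indep \<C>"
    using binary_matroid_cycles[OF assms(1,3)] by metis
  then interpret binary_cycles E indep \<C> .
  show ?thesis
  proof (cases "indep E")
    case True
    then have "\<not> circuit E indep C" for C
      using indep_subset[OF True] by (auto simp: circuit_def)
    then show ?thesis using card_indep_le_rank[OF True] assms(5) by simp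
  next
    case False
    obtain B k' where B: "indep B" "card B = r" and k': "k' \<le> k"
      and rank: "\<And>e g. e \<in> E - B \<Longrightarrow> g \<in> E - B \<Longrightarrow> e \<noteq> g \<Longrightarrow> r \<le> 3 * k' + 1"
      and size: "card (E - B) \<le> 1 + (\<Sum>i\<le>(3 * k' + 1 - r) div 2. k' choose i)"
      using paving_bounds[OF assms(4,5,7) False] by metis
    have "r \<le> 3 * k + 1" if "circuit E indep C" "circuit E indep D" "C \<noteq> D" for C D
      using two_circuits_cobasis[OF B(1) that] rank k' by (metis add_le_mono1 le_trans mult_le_mono2)
    moreover have "card E = r + card (E - B)"
      using B indep_subset_ground[OF B(1)] finite_ground finite_indep[OF B(1)]
      by (metis card_Diff_subset card_mono le_add_diff_inverse)
    moreover have "card (E - B) \<le> 1 + (\<Sum>i\<in>{0..t}. k choose nat i)"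
    \<comment> \<open>With at most one element outside \<open>B\<close> the summand 1 suffices,
      whatever the sign of \<open>t\<close>. With two, the rank bound makes the truncated
      subtraction agree with the integer one.\<close>
    proof (cases "card (E - B) \<le> 1")
      case False
      then obtain e g where "e \<in> E - B" "g \<in> E - B" "e \<noteq> g"
        by (metis card_le_Suc0_iff_eq finite_Diff finite_ground One_nat_def)
      then have r': "r \<le> 3 * k' + 1" using rank by blast
      have "t = (3 * int k + 1 - int r) div 2"
        unfolding assms(8) using floor_divide_of_int_eq[of "3 * int k + 1 - int r" 2, where 'a = real]
        by simp
      then have t: "t = int ((3 * k + 1 - r) div 2)" using r' k' by (simp add: of_nat_diff zdiv_int)
      have "(\<Sum>i\<le>(3 * k' + 1 - r) div 2. k' choose i) \<le> (\<Sum>i\<le>(3 * k + 1 - r) div 2. k choose i)"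
        using k' by (intro order_trans[OF sum_mono[OF binomial_mono_upper] sum_mono2])
          (auto intro!: div_le_mono)
      also have "\<dots> = (\<Sum>i\<in>{0..t}. k choose nat i)"
        unfolding t by (rule sum.reindex_bij_witness[of _ nat int]) auto
      finally show ?thesis using size False by simp
    qed simp
    ultimately show ?thesis by auto
  qed
qed

end
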